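(* For $n\geq1$, let $\alpha\in\mathbb C$, $K(h)\in\mathrm{GL}_n(\mathbb C[h])$, and let $\boldsymbol a=(a_-,a_0,a_+)\in\mathbb Z_{\geq0}^3$ satisfy $a_-+a_0+a_+=n$. Then $$M\big(\alpha,\boldsymbol a,K(h)\big)^\tau\simeq M\Big(\alpha,(a_+,a_0,a_-),\,\mathrm T_nK(-h-2)^{-1}\mathrm T_n\mathrm D_{\boldsymbol a}\Big),$$ where $$\mathrm D_{\boldsymbol a}:=\mathrm{diag}\big(\underbrace{1,\dots,1}_{a_+},\underbrace{-1,\dots,-1}_{a_0},\underbrace{1,\dots,1}_{a_-}\big).$$
   Context: The Lie algebra $\mathfrak{sl}(2)$ over $\mathbb C$ has basis $e,f,h$ with $[h,e]=e$, $[h,f]=-f$, $[e,f]=2h$; $\mathfrak h=\mathbb Ch$. The automorphism $\sigma$ of $\mathbb C[h]$ is $\sigma(g(h))=g(h-1)$, applied entrywise. For $E,F\in\mathrm{Mat}_n(\mathbb C[h])$ with $E\sigma(F)-F\sigma^{-1}(E)=2h\,\mathrm I_n$, $M(E,F)$ is the $\mathfrak{sl}(2)$-module on $\mathbb C[h]^{\oplus n}$ with $h$ acting by multiplication, $e\cdot\boldsymbol g=E\sigma(\boldsymbol g)$, $f\cdot\boldsymbol g=F\sigma^{-1}(\boldsymbol g)$. Put $\lambda_\alpha(h)=-(h-\alpha+1)(h+\alpha)$. For $\boldsymbol a\in\mathbb Z_{\geq0}^3$ with $a_-+a_0+a_+=n$, $P_{(\boldsymbol a,\alpha)}(h)$ is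 the diagonal $n\times n$ matrix with diagonal entries: $1$ ($a_-$ times), then $h-\alpha+1$ ($a_0$ times), then $(h-\alpha+1)(h+\alpha)$ ($a_+$ times); $\overline P_{(\boldsymbol a,\alpha)}(h)$ is the diagonal matrix with $\overline P_{(\boldsymbol a,\alpha)}P_{(\boldsymbol a,\alpha)}=\lambda_\alpha(h)\mathrm I_n$. Set $M(\alpha,\boldsymbol a,K(h)):=M\big(\sigma(K^{-1}(h)\overline P_{(\boldsymbol a,\alpha)}(h)),P_{(\boldsymbol a,\alpha)}(h)K(h)\big)$. $\mathrm T_n$ is the $n\times n$ antidiagonal permutation matrix (ones on the antidiagonal, zeros elsewhere). $\tau$ is the automorphism of $\mathfrak{sl}(2)$ with $\tau(e)=-f$, $\tau(f)=-e$, $\tau(h)=-h$. $M^\tau$ is the module with the same underlying space as $M$ on which $x$ acts as $\tau(x)$ acts on $M$. *)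

theory Defs
  imports "Jordan_Normal_Form.VS_Connect" "HOL-Computational_Algebra.Polynomial"
begin

section \<open>The Lie algebra \<open>sl(2)\<close>\<close>

definition sl2 :: "complex mat set" where
  "sl2 = {x \<in> carrier_mat 2 2. x $$ (0,0) + x $$ (1,1) = 0}"

definition lie :: "complex mat \<Rightarrow> complex mat \<Rightarrow> complex mat" where
  "lie x y = x * y - y * x"

text \<open>The generator \<open>h\<close> is half of the usual one, so that \<open>[h,e] = e\<close>, \<open>[h,f] = -f\<close>, \<open>[e,f] = 2h\<close>.\<close>

definition sl2_e :: "complex mat" where "sl2_e = mat_of_rows_list 2 [[0,1],[0,0]]"
definition sl2_f :: "complex mat" where "sl2_f = mat_of_rows_list 2 [[0,0],[1,0]]"
definition sl2_h :: "complex mat" where "sl2_h = mat_of_rows_list 2 [[1/2,0],[0,-1/2]]"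

definition coord_e :: "complex mat \<Rightarrow> complex" where "coord_e x = x $$ (0,1)"
definition coord_f :: "complex mat \<Rightarrow> complex" where "coord_f x = x $$ (1,0)"
definition coord_h :: "complex mat \<Rightarrow> complex" where "coord_h x = 2 * x $$ (0,0)"

definition sl2_tau :: "complex mat \<Rightarrow> complex mat" where
  "sl2_tau x = coord_e x \<cdot>\<^sub>m (- sl2_f) + coord_f x \<cdot>\<^sub>m (- sl2_e) + coord_h x \<cdot>\<^sub>m (- sl2_h)"


section \<open>\<open>sl(2)\<close>-modules\<close>

record 'v sl2_mod = "(complex, 'v) module" +
  act :: "complex mat \<Rightarrow> 'v \<Rightarrow> 'v"

locale sl2_module = vectorspace class_ring M
  for M :: "('v, 'm) sl2_mod_scheme" (structure) +
  assumes act_closed: "x \<in> sl2 \<Longrightarrow> v \<in> carrier M \<Longrightarrow> act M x v \<in> carrier M"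
    and act_add: "x \<in> sl2 \<Longrightarrow> v \<in> carrier M \<Longrightarrow> w \<in> carrier M \<Longrightarrow>
          act M x (v \<oplus>\<^bsub>M\<^esub> w) = act M x v \<oplus>\<^bsub>M\<^esub> act M x w"
    and act_smult: "x \<in> sl2 \<Longrightarrow> v \<in> carrier M \<Longrightarrow>
          act M x (c \<odot>\<^bsub>M\<^esub> v) = c \<odot>\<^bsub>M\<^esub> act M x v"
    and add_act: "x \<in> sl2 \<Longrightarrow> y \<in> sl2 \<Longrightarrow> v \<in> carrier M \<Longrightarrow>
          act M (x + y) v = act M x v \<oplus>\<^bsub>M\<^esub> act M y v"
    and smult_act: "x \<in> sl2 \<Longrightarrow> v \<in> carrier M \<Longrightarrow>
          act M (c \<cdot>\<^sub>m x) v = c \<odot>\<^bsub>M\<^esub> act M x v"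
    and lie_act: "x \<in> sl2 \<Longrightarrow> y \<in> sl2 \<Longrightarrow> v \<in> carrier M \<Longrightarrow>
          act M (lie x y) v = act M x (act M y v) \<ominus>\<^bsub>M\<^esub> act M y (act M x v)"

definition sl2_isomorphic :: "('v, 'm) sl2_mod_scheme \<Rightarrow> ('w, 'k) sl2_mod_scheme \<Rightarrow> bool"
    (infix \<open>\<simeq>\<^sub>s\<^sub>l\<^sub>2\<close> 50) where
  "M \<simeq>\<^sub>s\<^sub>l\<^sub>2 N \<longleftrightarrow> sl2_module M \<and> sl2_module N \<and>
     (\<exists>\<phi>. linear_map class_ring M N \<phi> \<and> bij_betw \<phi> (carrier M) (carrier N) \<and>
        (\<forall>x\<in>sl2. \<forall>v\<in>carrier M. \<phi> (act M x v) = act N x (\<phi> v)))"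

definition tau_twist :: "('v, 'm) sl2_mod_scheme \<Rightarrow> ('v, 'm) sl2_mod_scheme" where
  "tau_twist M = M\<lparr>act := \<lambda>x. act M (sl2_tau x)\<rparr>"


section \<open>The modules \<open>M(E,F)\<close> and \<open>M(\<alpha>,a,K)\<close>\<close>

text \<open>\<open>\<complex>[h]\<close> is the type \<^typ>\<open>complex poly\<close>, with \<open>h\<close> the polynomial \<open>[:0, 1:]\<close>.\<close>

definition sigma :: "complex poly \<Rightarrow> complex poly" where
  "sigma g = pcompose g [:-1, 1:]"

definition sigma_inv :: "complex poly \<Rightarrow> complex poly" where
  "sigma_inv g = pcompose g [:1, 1:]"

text \<open>Of the fields inherited from rings, \<open>mult\<close> and \<open>one\<close> play no role in a module.\<close>

definition M_EF :: "nat \<Rightarrow> complex poly mat \<Rightarrow> complex poly mat \<Rightarrow> complex poly vec sl2_mod" where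
  "M_EF n E F = \<lparr>
     carrier = carrier_vec n,
     mult = undefined,
     one = undefined,
     zero = 0\<^sub>v n,
     add = (+),
     smult = (\<lambda>c v. [:c:] \<cdot>\<^sub>v v),
     act = (\<lambda>x g. [:coord_e x:] \<cdot>\<^sub>v (E *\<^sub>v map_vec sigma g)
                + [:coord_f x:] \<cdot>\<^sub>v (F *\<^sub>v map_vec sigma_inv g)
                + [:coord_h x:] \<cdot>\<^sub>v ([:0, 1:] \<cdot>\<^sub>v g)) \<rparr>"

abbreviation poly_mat_ring :: "nat \<Rightarrow> complex poly mat ring" where
  "poly_mat_ring n \<equiv> ring_mat TYPE(complex poly) n ()"

abbreviation GL_poly :: "nat \<Rightarrow> complex poly mat set" where
  "GL_poly n \<equiv> Units (poly_mat_ring n)"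

definition block_diag3 :: "nat \<times> nat \<times> nat \<Rightarrow> 'a \<Rightarrow> 'a \<Rightarrow> 'a \<Rightarrow> 'a::zero mat" where
  "block_diag3 = (\<lambda>(k, l, m) x y z.
     mat_diag (k + l + m) (\<lambda>i. if i < k then x else if i < k + l then y else z))"

definition lambda_poly :: "complex \<Rightarrow> complex poly" where
  "lambda_poly \<alpha> = - ([:1 - \<alpha>, 1:] * [:\<alpha>, 1:])"

text \<open>A triple \<open>(k, l, m)\<close> stands for \<open>(a\<^sub>-, a\<^sub>0, a\<^sub>+)\<close>.\<close>

definition P_mat :: "nat \<times> nat \<times> nat \<Rightarrow> complex \<Rightarrow> complex poly mat" where
  "P_mat a \<alpha> = block_diag3 a 1 [:1 - \<alpha>, 1:] ([:1 - \<alpha>, 1:] * [:\<alpha>, 1:])"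

definition size3 :: "nat \<times> nat \<times> nat \<Rightarrow> nat" where
  "size3 = (\<lambda>(k, l, m). k + l + m)"

text \<open>Existence and uniqueness are \<open>P_bar_ex1\<close> below.\<close>

definition P_bar :: "nat \<times> nat \<times> nat \<Rightarrow> complex \<Rightarrow> complex poly mat" where
  "P_bar a \<alpha> = (THE Q. Q \<in> carrier_mat (size3 a) (size3 a) \<and> diagonal_mat Q \<and>
      Q * P_mat a \<alpha> = lambda_poly \<alpha> \<cdot>\<^sub>m 1\<^sub>m (size3 a))"

definition M_aK :: "complex \<Rightarrow> nat \<times> nat \<times> nat \<Rightarrow> complex poly mat \<Rightarrow> complex poly vec sl2_mod" where
  "M_aK \<alpha> a K = M_EF (size3 a)
     (map_mat sigma (inv\<^bsub>poly_mat_ring (size3 a)\<^esub> K * P_bar a \<alpha>))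
     (P_mat a \<alpha> * K)"

definition T_mat :: "nat \<Rightarrow> complex poly mat" where
  "T_mat n = mat n n (\<lambda>(i, j). if i + j + 1 = n then 1 else 0)"

definition D_mat :: "nat \<times> nat \<times> nat \<Rightarrow> complex poly mat" where
  "D_mat = (\<lambda>(am, a0, ap). block_diag3 (ap, a0, am) 1 (-1) 1)"


section \<open>Well-definedness\<close>

lemma mat2_eqI:
  assumes "A \<in> carrier_mat 2 2" "B \<in> carrier_mat 2 2"
    "A $$ (0,0) = B $$ (0,0)" "A $$ (0,1) = B $$ (0,1)"
    "A $$ (1,0) = B $$ (1,0)" "A $$ (1,1) = B $$ (1,1)"
  shows "A = B"
proof (rule eq_matI)
  fix i j assume "i < dim_row B" "j < dim_col B"
  then have "(i = 0 \<or> i = 1) \<and> (j = 0 \<or> j = 1)" using assms(2) by auto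
  then show "A $$ (i,j) = B $$ (i,j)" using assms by auto
qed (use assms in auto)

lemma basis_carrier [simp]:
  "sl2_e \<in> carrier_mat 2 2" "sl2_f \<in> carrier_mat 2 2" "sl2_h \<in> carrier_mat 2 2"
  by (auto simp: sl2_e_def sl2_f_def sl2_h_def mat_of_rows_list_def)

lemma basis_dim [simp]:
  "dim_row sl2_e = 2" "dim_col sl2_e = 2" "dim_row sl2_f = 2" "dim_col sl2_f = 2"
  "dim_row sl2_h = 2" "dim_col sl2_h = 2"
  by (simp_all add: carrier_matD[OF basis_carrier(1)] carrier_matD[OF basis_carrier(2)]
      carrier_matD[OF basis_carrier(3)])

lemma basis_entries [simp]:
  "sl2_e $$ (0,0) = 0" "sl2_e $$ (0,Suc 0) = 1" "sl2_e $$ (Suc 0,0) = 0" "sl2_e $$ (Suc 0,Suc 0) = 0"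
  "sl2_f $$ (0,0) = 0" "sl2_f $$ (0,Suc 0) = 0" "sl2_f $$ (Suc 0,0) = 1" "sl2_f $$ (Suc 0,Suc 0) = 0"
  "sl2_h $$ (0,0) = 1/2" "sl2_h $$ (0,Suc 0) = 0" "sl2_h $$ (Suc 0,0) = 0" "sl2_h $$ (Suc 0,Suc 0) = -1/2"
  by (auto simp: sl2_e_def sl2_f_def sl2_h_def mat_of_rows_list_def)

lemma mult2_entries:
  assumes "A \<in> carrier_mat 2 2" "B \<in> carrier_mat 2 2" "i < 2" "j < 2"
  shows "(A * B) $$ (i,j) = A $$ (i,0) * B $$ (0,j) + A $$ (i,1) * B $$ (1,j)"
  using assms by (auto simp: scalar_prod_def numeral_2_eq_2)

lemma lie_carrier: "x \<in> carrier_mat 2 2 \<Longrightarrow> y \<in> carrier_mat 2 2 \<Longrightarrow> lie x y \<in> carrier_mat 2 2"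
  by (auto simp: lie_def)

lemma lie_entries:
  assumes "x \<in> carrier_mat 2 2" "y \<in> carrier_mat 2 2" "i < 2" "j < 2"
  shows "lie x y $$ (i,j) = x $$ (i,0) * y $$ (0,j) + x $$ (i,1) * y $$ (1,j)
     - (y $$ (i,0) * x $$ (0,j) + y $$ (i,1) * x $$ (1,j))"
proof -
  have "y * x \<in> carrier_mat 2 2" using assms by auto
  then have "lie x y $$ (i,j) = (x * y) $$ (i,j) - (y * x) $$ (i,j)"
    using assms unfolding lie_def by (intro index_minus_mat(1)) auto
  then show ?thesis using assms by (simp only: mult2_entries)
qed

lemma sl2_brackets:
  "lie sl2_h sl2_e = sl2_e" "lie sl2_h sl2_f = - sl2_f" "lie sl2_e sl2_f = 2 \<cdot>\<^sub>m sl2_h"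
  by (rule mat2_eqI; simp add: lie_carrier lie_entries)+

lemma basis_in_sl2 [simp]: "sl2_e \<in> sl2" "sl2_f \<in> sl2" "sl2_h \<in> sl2"
  by (auto simp: sl2_def)

lemma sl2_expand:
  assumes "x \<in> sl2"
  shows "x = coord_e x \<cdot>\<^sub>m sl2_e + coord_f x \<cdot>\<^sub>m sl2_f + coord_h x \<cdot>\<^sub>m sl2_h"
  using assms by (intro mat2_eqI)
    (auto simp: sl2_def coord_e_def coord_f_def coord_h_def add_eq_0_iff)

lemma coords_basis [simp]:
  "coord_e sl2_e = 1" "coord_f sl2_e = 0" "coord_h sl2_e = 0"
  "coord_e sl2_f = 0" "coord_f sl2_f = 1" "coord_h sl2_f = 0"
  "coord_e sl2_h = 0" "coord_f sl2_h = 0" "coord_h sl2_h = 1"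
  by (simp_all add: coord_e_def coord_f_def coord_h_def)

lemma lie_closed: "x \<in> sl2 \<Longrightarrow> y \<in> sl2 \<Longrightarrow> lie x y \<in> sl2"
  by (auto simp: sl2_def lie_carrier lie_entries)

lemma sl2_tau_carrier: "sl2_tau x \<in> carrier_mat 2 2"
  by (simp add: sl2_tau_def)

lemma sl2_tau_dim [simp]: "dim_row (sl2_tau x) = 2" "dim_col (sl2_tau x) = 2"
  using sl2_tau_carrier[of x] by auto

lemma sl2_tau_entries:
  "sl2_tau x $$ (0,0) = - x $$ (0,0)" "sl2_tau x $$ (0,Suc 0) = - x $$ (Suc 0,0)"
  "sl2_tau x $$ (Suc 0,0) = - x $$ (0,Suc 0)" "sl2_tau x $$ (Suc 0,Suc 0) = x $$ (0,0)"
  by (simp_all add: sl2_tau_def coord_e_def coord_f_def coord_h_def)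

lemma sl2_tau_basis: "sl2_tau sl2_e = - sl2_f" "sl2_tau sl2_f = - sl2_e" "sl2_tau sl2_h = - sl2_h"
  by (rule mat2_eqI; simp add: sl2_tau_carrier sl2_tau_entries)+

lemma sl2_tau_closed: "x \<in> sl2 \<Longrightarrow> sl2_tau x \<in> sl2"
  by (simp add: sl2_def sl2_tau_carrier sl2_tau_entries)

lemma sl2_tau_add: "x \<in> sl2 \<Longrightarrow> y \<in> sl2 \<Longrightarrow> sl2_tau (x + y) = sl2_tau x + sl2_tau y"
  using sl2_tau_carrier[of x] sl2_tau_carrier[of y]
  by (intro mat2_eqI) (auto simp: sl2_tau_carrier sl2_tau_entries sl2_def)

lemma sl2_tau_smult: "x \<in> sl2 \<Longrightarrow> sl2_tau (c \<cdot>\<^sub>m x) = c \<cdot>\<^sub>m sl2_tau x"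
  using sl2_tau_carrier[of x]
  by (intro mat2_eqI) (auto simp: sl2_tau_carrier sl2_tau_entries sl2_def)

lemma sl2_tau_lie:
  assumes "x \<in> sl2" "y \<in> sl2"
  shows "sl2_tau (lie x y) = lie (sl2_tau x) (sl2_tau y)"
proof -
  have c: "x \<in> carrier_mat 2 2" "y \<in> carrier_mat 2 2" using assms by (auto simp: sl2_def)
  have d: "x $$ (Suc 0,Suc 0) = - x $$ (0,0)" "y $$ (Suc 0,Suc 0) = - y $$ (0,0)"
    using assms by (auto simp: sl2_def add_eq_0_iff)
  show ?thesis
    by (rule mat2_eqI)
      (simp_all add: c d sl2_tau_carrier sl2_tau_entries lie_carrier lie_entries algebra_simps)
qed

lemma sl2_tau_tau: "x \<in> sl2 \<Longrightarrow> sl2_tau (sl2_tau x) = x"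
  by (rule mat2_eqI) (auto simp: sl2_tau_carrier sl2_tau_entries sl2_def add_eq_0_iff)

lemma sigma_inverse: "sigma (sigma_inv g) = g" "sigma_inv (sigma g) = g"
  by (simp_all add: sigma_def sigma_inv_def pcompose_assoc[symmetric] pcompose_pCons)

lemma tau_twist_sl2_module:
  assumes "sl2_module M"
  shows "sl2_module (tau_twist M)"
proof -
  interpret sl2_module M by fact
  have V: "vectorspace class_ring (tau_twist M)"
    using vectorspace_axioms
    by (simp add: tau_twist_def vectorspace_def Module.module_def module_axioms_def
        abelian_group_def abelian_group_axioms_def abelian_monoid_def)
  have minus: "a \<ominus>\<^bsub>tau_twist M\<^esub> b = a \<ominus>\<^bsub>M\<^esub> b" for a b
    by (simp add: tau_twist_def a_minus_def a_inv_def)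
  show ?thesis
    by (intro sl2_module.intro sl2_module_axioms.intro V)
      (auto simp: tau_twist_def minus[unfolded tau_twist_def] sl2_tau_closed sl2_tau_add
        sl2_tau_smult sl2_tau_lie act_closed act_add act_smult add_act smult_act lie_act)
qed

lemma map_sigma_vec:
  "g \<in> carrier_vec n \<Longrightarrow> g' \<in> carrier_vec n \<Longrightarrow>
     map_vec sigma (g + g') = map_vec sigma g + map_vec sigma g'"
  "map_vec sigma (p \<cdot>\<^sub>v g) = sigma p \<cdot>\<^sub>v map_vec sigma g"
  "g \<in> carrier_vec n \<Longrightarrow> g' \<in> carrier_vec n \<Longrightarrow>
     map_vec sigma_inv (g + g') = map_vec sigma_inv g + map_vec sigma_inv g'"
  "map_vec sigma_inv (p \<cdot>\<^sub>v g) = sigma_inv p \<cdot>\<^sub>v map_vec sigma_inv g"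
  by (auto simp: sigma_def sigma_inv_def pcompose_add pcompose_mult)

lemma sigma_hom:
  "sigma (p + q) = sigma p + sigma q" "sigma (p * q) = sigma p * sigma q"
  "sigma (sum r A) = (\<Sum>i\<in>A. sigma (r i))" "sigma [:c:] = [:c:]"
  "sigma_inv (p + q) = sigma_inv p + sigma_inv q" "sigma_inv (p * q) = sigma_inv p * sigma_inv q"
  "sigma_inv (sum r A) = (\<Sum>i\<in>A. sigma_inv (r i))" "sigma_inv [:c:] = [:c:]"
  by (simp_all add: sigma_def sigma_inv_def pcompose_add pcompose_mult pcompose_sum)

lemma map_sigma_mult_vec:
  assumes "A \<in> carrier_mat n n" "g \<in> carrier_vec n"
  shows "map_vec sigma (A *\<^sub>v g) = map_mat sigma A *\<^sub>v map_vec sigma g"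
    "map_vec sigma_inv (A *\<^sub>v g) = map_mat sigma_inv A *\<^sub>v map_vec sigma_inv g"
  using assms by (auto intro!: eq_vecI simp: scalar_prod_def sigma_hom)

lemma M_EF_vectorspace: "vectorspace class_ring (M_EF n E F)"
proof -
  have ab: "abelian_group (M_EF n E F)"
    by (rule abelian_groupI)
      (auto simp: M_EF_def comm_add_vec intro!: bexI[of _ "- x" for x])
  show ?thesis
    by (intro vectorspace.intro moduleI ab class_field.field_axioms class_cring.cring_axioms)
      (auto simp: M_EF_def smult_add_distrib_vec smult_smult_assoc algebra_simps
        Polynomial.smult_add_left intro!: eq_vecI)
qed

text \<open>The relation \<open>E \<sigma>(F) - F \<sigma>\<^sup>-\<^sup>1(E) = 2h\<close> makes \<open>M(E,F)\<close> a module.\<close>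

lemma M_EF_sl2_module:
  assumes E: "E \<in> carrier_mat n n" and F: "F \<in> carrier_mat n n"
    and rel: "E * map_mat sigma F - F * map_mat sigma_inv E = [:0, 2:] \<cdot>\<^sub>m 1\<^sub>m n"
  shows "sl2_module (M_EF n E F)"
proof -
  let ?h = "[:0, 1:] :: complex poly"
  define e f where "e = (\<lambda>g. E *\<^sub>v map_vec sigma g)" and "f = (\<lambda>g. F *\<^sub>v map_vec sigma_inv g)"
  interpret V: vectorspace class_ring "M_EF n E F" by (rule M_EF_vectorspace)
  have ms: "map_vec sigma g \<in> carrier_vec n" "map_vec sigma_inv g \<in> carrier_vec n"
    if "g \<in> carrier_vec n" for g using that by auto
  have ec: "e g \<in> carrier_vec n" and fc: "f g \<in> carrier_vec n" if "g \<in> carrier_vec n" for g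
    using that E F by (auto simp: e_def f_def)
  have eadd: "e (g + g') = e g + e g'" and fadd: "f (g + g') = f g + f g'"
    if "g \<in> carrier_vec n" "g' \<in> carrier_vec n" for g g'
    using that E F ms by (simp_all add: e_def f_def map_sigma_vec(1,3)[where n = n] mult_add_distrib_mat_vec[of _ n n])
  have esm: "e (p \<cdot>\<^sub>v g) = sigma p \<cdot>\<^sub>v e g" and fsm: "f (p \<cdot>\<^sub>v g) = sigma_inv p \<cdot>\<^sub>v f g"
    if "g \<in> carrier_vec n" for p g
    using that E F
    by (auto simp: e_def f_def map_sigma_vec(2,4) scalar_prod_def sum_distrib_left
        algebra_simps intro!: eq_vecI sum.cong)
  have ef: "e (f g) = f (e g) + [:0, 2:] \<cdot>\<^sub>v g" if g: "g \<in> carrier_vec n" for g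
  proof -
    let ?X = "E * map_mat sigma F" and ?Y = "F * map_mat sigma_inv E"
    have X: "?X \<in> carrier_mat n n" and Y: "?Y \<in> carrier_mat n n" using E F by auto
    have id: "map_vec sigma (map_vec sigma_inv g) = g" "map_vec sigma_inv (map_vec sigma g) = g"
      by (auto simp: sigma_inverse)
    have 1: "e (f g) = ?X *\<^sub>v g" "f (e g) = ?Y *\<^sub>v g"
      using E F g ms[OF g]
      by (simp_all add: e_def f_def map_sigma_mult_vec[of _ n] id assoc_mult_mat_vec[of _ n n _ n])
    have "(?X - ?Y) *\<^sub>v g = ?X *\<^sub>v g - ?Y *\<^sub>v g"
      using X Y g by (rule minus_mult_distrib_mat_vec)
    moreover have "(?X - ?Y) *\<^sub>v g = [:0, 2:] \<cdot>\<^sub>v g"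
      unfolding rel using g by auto
    ultimately have "?X *\<^sub>v g - ?Y *\<^sub>v g = [:0, 2:] \<cdot>\<^sub>v g" by simp
    moreover have "?X *\<^sub>v g = ?Y *\<^sub>v g + (?X *\<^sub>v g - ?Y *\<^sub>v g)"
      using X Y E F g by (intro eq_vecI) auto
    ultimately show ?thesis using 1 by simp
  qed
  have act: "act (M_EF n E F) x g =
      [:coord_e x:] \<cdot>\<^sub>v e g + [:coord_f x:] \<cdot>\<^sub>v f g + [:coord_h x:] \<cdot>\<^sub>v (?h \<cdot>\<^sub>v g)" for x g
    by (simp add: M_EF_def e_def f_def)
  have minus: "u \<ominus>\<^bsub>M_EF n E F\<^esub> v = u - v" if "u \<in> carrier_vec n" "v \<in> carrier_vec n" for u v
  proof -
    have "\<ominus>\<^bsub>M_EF n E F\<^esub> v = - v"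
      by (rule V.minus_equality) (use that in \<open>auto simp: M_EF_def\<close>)
    then show ?thesis using that
      by (auto simp: a_minus_def M_EF_def intro!: eq_vecI)
  qed
  have sc: "carrier (M_EF n E F) = carrier_vec n" "add (M_EF n E F) = (+)"
    "smult (M_EF n E F) = (\<lambda>c v. [:c:] \<cdot>\<^sub>v v)"
    by (simp_all add: M_EF_def)
  have sh: "sigma ?h = ?h - 1" "sigma_inv ?h = ?h + 1"
    by (simp_all add: sigma_def sigma_inv_def pcompose_pCons one_pCons)
  have actc: "act (M_EF n E F) x v \<in> carrier_vec n" if "v \<in> carrier_vec n" for x v
    using that ec fc by (simp add: act)
  show ?thesis
  proof (intro sl2_module.intro sl2_module_axioms.intro M_EF_vectorspace, unfold sc)
    fix x and v w :: "complex poly vec" assume "v \<in> carrier_vec n" "w \<in> carrier_vec n"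
    then show "act (M_EF n E F) x (v + w) = act (M_EF n E F) x v + act (M_EF n E F) x w"
      using ec[of v] fc[of v] ec[of w] fc[of w]
      by (intro eq_vecI) (auto simp: act eadd fadd algebra_simps)
  next
    fix x c and v :: "complex poly vec" assume "v \<in> carrier_vec n"
    then show "act (M_EF n E F) x ([:c:] \<cdot>\<^sub>v v) = [:c:] \<cdot>\<^sub>v act (M_EF n E F) x v"
      using ec[of v] fc[of v]
      by (intro eq_vecI) (auto simp: act esm fsm sigma_hom algebra_simps)
  next
    fix x y and v :: "complex poly vec" assume "x \<in> sl2" "y \<in> sl2" and v: "v \<in> carrier_vec n"
    then have c: "[:coord_e (x + y):] = [:coord_e x:] + [:coord_e y:]"
      "[:coord_f (x + y):] = [:coord_f x:] + [:coord_f y:]"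
      "[:coord_h (x + y):] = [:coord_h x:] + [:coord_h y:]"
      by (auto simp: sl2_def coord_e_def coord_f_def coord_h_def)
    show "act (M_EF n E F) (x + y) v = act (M_EF n E F) x v + act (M_EF n E F) y v"
      unfolding act c using v ec[of v] fc[of v]
      by (intro eq_vecI) (auto simp: algebra_simps simp del: add_pCons)
  next
    fix x c and v :: "complex poly vec" assume "x \<in> sl2" and v: "v \<in> carrier_vec n"
    then have c: "[:coord_e (c \<cdot>\<^sub>m x):] = [:c:] * [:coord_e x:]"
      "[:coord_f (c \<cdot>\<^sub>m x):] = [:c:] * [:coord_f x:]"
      "[:coord_h (c \<cdot>\<^sub>m x):] = [:c:] * [:coord_h x:]"
      by (auto simp: sl2_def coord_e_def coord_f_def coord_h_def)
    show "act (M_EF n E F) (c \<cdot>\<^sub>m x) v = [:c:] \<cdot>\<^sub>v act (M_EF n E F) x v"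
      unfolding act c using v ec[of v] fc[of v]
      by (intro eq_vecI) (auto simp: algebra_simps simp del: mult_pCons_left mult_pCons_right)
  next
    fix x y and v :: "complex poly vec" assume x: "x \<in> sl2" and y: "y \<in> sl2" and v: "v \<in> carrier_vec n"
    have xy: "x \<in> carrier_mat 2 2" "y \<in> carrier_mat 2 2"
      "x $$ (Suc 0, Suc 0) = - x $$ (0,0)" "y $$ (Suc 0, Suc 0) = - y $$ (0,0)"
      using x y by (auto simp: sl2_def add_eq_0_iff)
    have c: "[:coord_e (lie x y):] = [:coord_h x:] * [:coord_e y:] - [:coord_e x:] * [:coord_h y:]"
      "[:coord_f (lie x y):] = [:coord_f x:] * [:coord_h y:] - [:coord_h x:] * [:coord_f y:]"
      "[:coord_h (lie x y):] = 2 * ([:coord_e x:] * [:coord_f y:] - [:coord_f x:] * [:coord_e y:])"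
      using xy by (simp_all add: coord_e_def coord_f_def coord_h_def lie_entries numeral_poly algebra_simps)
    note cl = v ec[OF v] fc[OF v] ec[OF ec[OF v]] ec[OF fc[OF v]] fc[OF ec[OF v]] fc[OF fc[OF v]]
    have two: "[:0, 2:] = 2 * ?h" by (simp add: numeral_poly)
    have aa: "act (M_EF n E F) x (act (M_EF n E F) y v) =
       [:coord_e x:] \<cdot>\<^sub>v ([:coord_e y:] \<cdot>\<^sub>v e (e v) + [:coord_f y:] \<cdot>\<^sub>v (f (e v) + (2 * ?h) \<cdot>\<^sub>v v)
          + [:coord_h y:] \<cdot>\<^sub>v ((?h - 1) \<cdot>\<^sub>v e v))
     + [:coord_f x:] \<cdot>\<^sub>v ([:coord_e y:] \<cdot>\<^sub>v f (e v) + [:coord_f y:] \<cdot>\<^sub>v f (f v)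
          + [:coord_h y:] \<cdot>\<^sub>v ((?h + 1) \<cdot>\<^sub>v f v))
     + [:coord_h x:] \<cdot>\<^sub>v (?h \<cdot>\<^sub>v ([:coord_e y:] \<cdot>\<^sub>v e v + [:coord_f y:] \<cdot>\<^sub>v f v
          + [:coord_h y:] \<cdot>\<^sub>v (?h \<cdot>\<^sub>v v)))" for x y
      unfolding act using cl
      by (simp only: eadd fadd esm fsm sigma_hom sh ef two add_carrier_vec smult_carrier_vec)
    show "act (M_EF n E F) (lie x y) v =
      act (M_EF n E F) x (act (M_EF n E F) y v) \<ominus>\<^bsub>M_EF n E F\<^esub> act (M_EF n E F) y (act (M_EF n E F) x v)"
      unfolding minus[OF actc[OF actc[OF v]] actc[OF actc[OF v]]]
      unfolding aa unfolding act c
    proof (rule eq_vecI, goal_cases)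
      case (1 i)
      then have i: "i < n" using cl by auto
      define X1 X2 X3 Y1 Y2 Y3 H where "X1 = [:coord_e x:]" "X2 = [:coord_f x:]" "X3 = [:coord_h x:]"
        "Y1 = [:coord_e y:]" "Y2 = [:coord_f y:]" "Y3 = [:coord_h y:]" "H = ?h"
      show ?case
        unfolding X1_X2_X3_Y1_Y2_Y3_H_def[symmetric]
        using i cl by (auto simp: algebra_simps)
    qed (use cl in auto)
  qed (use actc in auto)
qed

lemma block_diag3_carrier: "block_diag3 a x y z \<in> carrier_mat (size3 a) (size3 a)"
  by (cases a) (simp add: block_diag3_def size3_def)

lemma P_bar_props:
  fixes a \<alpha>
  defines "Q \<equiv> block_diag3 a (lambda_poly \<alpha>) (- [:\<alpha>, 1:]) (-1)"
  shows "Q \<in> carrier_mat (size3 a) (size3 a) \<and> diagonal_mat Q \<and>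
      Q * P_mat a \<alpha> = lambda_poly \<alpha> \<cdot>\<^sub>m 1\<^sub>m (size3 a)"
proof (cases a)
  case (fields k l m)
  have "Q * P_mat a \<alpha> = lambda_poly \<alpha> \<cdot>\<^sub>m 1\<^sub>m (size3 a)"
    unfolding Q_def P_mat_def fields block_diag3_def size3_def prod.case mat_diag_diag
    by (rule eq_matI) (auto simp: mat_diag_def lambda_poly_def one_pCons)
  moreover have "diagonal_mat Q"
    by (auto simp: Q_def fields block_diag3_def diagonal_mat_def mat_diag_def)
  ultimately show ?thesis using block_diag3_carrier[of a] Q_def by blast
qed

lemma P_bar_ex1:
  "\<exists>!Q. Q \<in> carrier_mat (size3 a) (size3 a) \<and> diagonal_mat Q \<and>
      Q * P_mat a \<alpha> = lambda_poly \<alpha> \<cdot>\<^sub>m 1\<^sub>m (size3 a)"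
proof (rule ex_ex1I)
  show "\<exists>Q. Q \<in> carrier_mat (size3 a) (size3 a) \<and> diagonal_mat Q \<and>
      Q * P_mat a \<alpha> = lambda_poly \<alpha> \<cdot>\<^sub>m 1\<^sub>m (size3 a)"
    using P_bar_props by blast
next
  fix Q R :: "complex poly mat"
  let ?n = "size3 a"
  assume Q: "Q \<in> carrier_mat ?n ?n \<and> diagonal_mat Q \<and> Q * P_mat a \<alpha> = lambda_poly \<alpha> \<cdot>\<^sub>m 1\<^sub>m ?n"
    and R: "R \<in> carrier_mat ?n ?n \<and> diagonal_mat R \<and> R * P_mat a \<alpha> = lambda_poly \<alpha> \<cdot>\<^sub>m 1\<^sub>m ?n"
  obtain k l m where a: "a = (k, l, m)" by (cases a)
  define p where "p = (\<lambda>i. if i < k then 1 else if i < k + l then [:1 - \<alpha>, 1:]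
      else [:1 - \<alpha>, 1:] * [:\<alpha>, 1:])"
  have P: "P_mat a \<alpha> = mat_diag ?n p"
    by (simp only: P_mat_def a block_diag3_def size3_def p_def prod.case)
  have nz: "p i \<noteq> 0" for i by (simp add: p_def)
  show "Q = R"
  proof (rule eq_matI)
    fix i j assume ij: "i < dim_row R" "j < dim_col R"
    then have ij': "i < ?n" "j < ?n" using R by auto
    have "(Q * mat_diag ?n p) $$ (i,j) = (R * mat_diag ?n p) $$ (i,j)"
      using Q R P by simp
    then have "Q $$ (i,j) * p j = R $$ (i,j) * p j"
      using ij' Q R by (simp add: mat_diag_mult_right[of _ ?n])
    then show "Q $$ (i,j) = R $$ (i,j)" using nz by simp
  qed (use Q R in auto)
qed

lemma P_bar_eq: "P_bar a \<alpha> = block_diag3 a (lambda_poly \<alpha>) (- [:\<alpha>, 1:]) (-1)"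
  unfolding P_bar_def by (rule the1_equality[OF P_bar_ex1 P_bar_props])

end

theory Submission
  imports Defs
begin

text \<open>
  Since \<open>h\<close> acts on \<open>M\<^sup>\<tau>\<close> by \<open>-h\<close>, an isomorphism onto \<open>M(E',F')\<close> must have the form
  \<open>g(h) \<mapsto> A(h) g(-h)\<close>. Intertwining \<open>e\<close> and \<open>f\<close> means \<open>E'(h) A(h-1) = -A(h) F(-h)\<close> and
  \<open>F'(h) A(h+1) = -A(h) E(-h)\<close>. Both hold for \<open>A(h) = D T K(-h-1)\<close>, because the substitution
  \<open>h \<mapsto> -h-1\<close> fixes \<open>\<lambda>\<^sub>\<alpha>\<close> and interchanges its two linear factors up to sign.
\<close>

section \<open>Substitution of a polynomial for h in matrices and vectors\<close>

abbreviation subst_mat :: "complex poly \<Rightarrow> complex poly mat \<Rightarrow> complex poly mat" where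
  "subst_mat q \<equiv> map_mat (\<lambda>g. pcompose g q)"

abbreviation subst_vec :: "complex poly \<Rightarrow> complex poly vec \<Rightarrow> complex poly vec" where
  "subst_vec q \<equiv> map_vec (\<lambda>g. pcompose g q)"

lemma sigma_pcompose: "sigma = (\<lambda>g. pcompose g [:-1, 1:])" "sigma_inv = (\<lambda>g. pcompose g [:1, 1:])"
  by (auto simp: sigma_def sigma_inv_def)

lemma subst_mat_mult:
  assumes "A \<in> carrier_mat n n" "B \<in> carrier_mat n n"
  shows "subst_mat q (A * B) = subst_mat q A * subst_mat q B"
  using assms by (intro eq_matI) (auto simp: scalar_prod_def pcompose_sum pcompose_mult)

lemma subst_mat_one: "subst_mat q (1\<^sub>m n) = 1\<^sub>m n"
  by (intro eq_matI) (auto simp: pcompose_1)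

text \<open>The substitution made last is the inner one of the composite, so \<sigma> after h ->
  -h-1 gives -(h-1)-1 = -h. All shifts below are computed this way.\<close>

lemma subst_mat_subst: "subst_mat q (subst_mat p A) = subst_mat (pcompose p q) A"
  by (intro eq_matI) (auto simp: pcompose_assoc)

lemma subst_vec_subst: "subst_vec q (subst_vec p v) = subst_vec (pcompose p q) v"
  by (intro eq_vecI) (auto simp: pcompose_assoc)

lemma subst_vec_add:
  "u \<in> carrier_vec n \<Longrightarrow> v \<in> carrier_vec n \<Longrightarrow> subst_vec q (u + v) = subst_vec q u + subst_vec q v"
  by (intro eq_vecI) (auto simp: pcompose_add)

lemma subst_vec_smult: "subst_vec q (p \<cdot>\<^sub>v v) = pcompose p q \<cdot>\<^sub>v subst_vec q v"
  by (intro eq_vecI) (auto simp: pcompose_mult)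

lemma subst_mat_mult_vec:
  assumes "A \<in> carrier_mat n n" "v \<in> carrier_vec n"
  shows "subst_vec q (A *\<^sub>v v) = subst_mat q A *\<^sub>v subst_vec q v"
  using assms by (intro eq_vecI) (auto simp: scalar_prod_def pcompose_sum pcompose_mult)

lemma mult_mat_smult_vec:
  fixes A :: "'a :: comm_ring_1 mat"
  assumes "A \<in> carrier_mat m n" "v \<in> carrier_vec n"
  shows "A *\<^sub>v (k \<cdot>\<^sub>v v) = k \<cdot>\<^sub>v (A *\<^sub>v v)"
  using assms by (intro eq_vecI) auto

section \<open>A criterion for a twisted module to be isomorphic to a given M(E',F')\<close>

lemma coords_tau:
  assumes "x \<in> sl2"
  shows "coord_e (sl2_tau x) = - coord_f x" "coord_f (sl2_tau x) = - coord_e x"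
    "coord_h (sl2_tau x) = - coord_h x"
  using assms by (simp_all add: coord_e_def coord_f_def coord_h_def sl2_tau_entries)

text \<open>Since \<tau> exchanges e and f up to sign, \<open>e\<close> pairs E' with F and
  \<open>f\<close> pairs F' with E. The matrix B is the inverse of A and makes the map
  bijective.\<close>

lemma M_EF_tau_twist_iso:
  assumes E: "E \<in> carrier_mat n n" and F: "F \<in> carrier_mat n n"
    and E': "E' \<in> carrier_mat n n" and F': "F' \<in> carrier_mat n n"
    and A: "A \<in> carrier_mat n n" and B: "B \<in> carrier_mat n n"
    and AB: "A * B = 1\<^sub>m n" and BA: "B * A = 1\<^sub>m n"
    and M: "sl2_module (M_EF n E F)" and N: "sl2_module (M_EF n E' F')"
    and e: "E' * map_mat sigma A = - (A * subst_mat [:0, -1:] F)"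
    and f: "F' * map_mat sigma_inv A = - (A * subst_mat [:0, -1:] E)"
  shows "tau_twist (M_EF n E F) \<simeq>\<^sub>s\<^sub>l\<^sub>2 M_EF n E' F'"
proof -
  let ?r = "subst_vec [:0, -1:]" and ?R = "subst_mat [:0, -1:]"
  define \<phi> where "\<phi> v = A *\<^sub>v ?r v" for v
  have sc: "carrier (M_EF n E F) = carrier_vec n" "add (M_EF n E F) = (+)"
    "smult (M_EF n E F) = (\<lambda>c v. [:c:] \<cdot>\<^sub>v v)" for E F
    by (simp_all add: M_EF_def)
  have sct: "carrier (tau_twist (M_EF n E F)) = carrier_vec n" "add (tau_twist (M_EF n E F)) = (+)"
    "smult (tau_twist (M_EF n E F)) = (\<lambda>c v. [:c:] \<cdot>\<^sub>v v)"
    by (simp_all add: M_EF_def tau_twist_def)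
  have rc: "?r v \<in> carrier_vec n" if "v \<in> carrier_vec n" for v using that by auto
  have c: "\<phi> v \<in> carrier_vec n" if "v \<in> carrier_vec n" for v
    using that A by (simp add: \<phi>_def)
  have add: "\<phi> (u + v) = \<phi> u + \<phi> v" if "u \<in> carrier_vec n" "v \<in> carrier_vec n" for u v
    using that A rc by (simp add: \<phi>_def subst_vec_add[of _ n] mult_add_distrib_mat_vec[of _ n n])
  \<comment> \<open>\<open>\<phi>\<close> is semilinear over h -> -h: constant p gives complex
    linearity, and p = h gives the sign in the action of h.\<close>
  have sm: "\<phi> (p \<cdot>\<^sub>v v) = pcompose p [:0, -1:] \<cdot>\<^sub>v \<phi> v" if "v \<in> carrier_vec n" for p v
    using that A rc by (simp add: \<phi>_def subst_vec_smult mult_mat_smult_vec[OF A])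
  have rr: "?r (?r v) = v" for v
    by (intro eq_vecI) (simp_all add: pcompose_assoc[symmetric] pcompose_pCons)
  have bij: "bij_betw \<phi> (carrier_vec n) (carrier_vec n)"
  proof (rule bij_betw_byWitness[where f' = "\<lambda>v. ?r (B *\<^sub>v v)"])
    show "\<forall>v\<in>carrier_vec n. ?r (B *\<^sub>v \<phi> v) = v"
    proof
      fix v :: "complex poly vec" assume v: "v \<in> carrier_vec n"
      have "B *\<^sub>v \<phi> v = (B * A) *\<^sub>v ?r v"
        unfolding \<phi>_def using A B rc[OF v] by (simp add: assoc_mult_mat_vec[of _ n n _ n])
      then show "?r (B *\<^sub>v \<phi> v) = v" using rc[OF v] by (simp add: BA rr)
    qed
    show "\<forall>v\<in>carrier_vec n. \<phi> (?r (B *\<^sub>v v)) = v"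
    proof
      fix v :: "complex poly vec" assume v: "v \<in> carrier_vec n"
      have "\<phi> (?r (B *\<^sub>v v)) = (A * B) *\<^sub>v v"
        unfolding \<phi>_def rr using A B v by (simp add: assoc_mult_mat_vec[of _ n n _ n])
      then show "\<phi> (?r (B *\<^sub>v v)) = v" using v by (simp add: AB)
    qed
  qed (use B c in auto)
  have lin: "linear_map class_ring (tau_twist (M_EF n E F)) (M_EF n E' F') \<phi>"
  proof -
    have "vectorspace class_ring (tau_twist (M_EF n E F))"
      using tau_twist_sl2_module[OF M] sl2_module.axioms(1) by blast
    moreover have "\<phi> \<in> LinearCombinations.module_hom class_ring (tau_twist (M_EF n E F)) (M_EF n E' F')"
      unfolding LinearCombinations.module_hom_def sc sct
      using c add sm by (auto simp: pcompose_const)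
    ultimately show ?thesis
      using M_EF_vectorspace[of n E' F']
      by (simp add: linear_map_def mod_hom_def mod_hom_axioms_def vectorspace_def)
  qed
  have actM: "\<phi> (act (tau_twist (M_EF n E F)) x v) = act (M_EF n E' F') x (\<phi> v)"
    if x: "x \<in> sl2" and v: "v \<in> carrier_vec n" for x v
  proof -
    let ?s = "map_vec sigma" and ?t = "map_vec sigma_inv"
    have cl: "?s v \<in> carrier_vec n" "?t v \<in> carrier_vec n" "?s (?r v) \<in> carrier_vec n"
      "?t (?r v) \<in> carrier_vec n"
      using v by auto
    \<comment> \<open>Reflection turns a shift into the opposite shift, as (-h)-1 = -(h+1). Hence
      the E-term of the source meets \<open>sigma_inv\<close>, the shift that accompanies F' in the
      target.\<close>
    have swap: "?r (?s v) = ?t (?r v)" "?r (?t v) = ?s (?r v)"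
      by (simp_all add: sigma_pcompose subst_vec_subst pcompose_pCons)
    have "\<phi> (E *\<^sub>v ?s v) = (A * ?R E) *\<^sub>v ?t (?r v)"
      using A E cl by (simp add: \<phi>_def subst_mat_mult_vec[of _ n] swap assoc_mult_mat_vec[of _ n n _ n])
    moreover have "F' *\<^sub>v ?t (\<phi> v) = (F' * map_mat sigma_inv A) *\<^sub>v ?t (?r v)"
      unfolding \<phi>_def map_sigma_mult_vec(2)[OF A rc[OF v]]
      using A F' cl by (intro assoc_mult_mat_vec[symmetric]) auto
    ultimately have 1: "F' *\<^sub>v ?t (\<phi> v) = - \<phi> (E *\<^sub>v ?s v)"
      unfolding f using A E cl by (auto intro!: eq_vecI)
    have "\<phi> (F *\<^sub>v ?t v) = (A * ?R F) *\<^sub>v ?s (?r v)"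
      using A F cl by (simp add: \<phi>_def subst_mat_mult_vec[of _ n] swap assoc_mult_mat_vec[of _ n n _ n])
    moreover have "E' *\<^sub>v ?s (\<phi> v) = (E' * map_mat sigma A) *\<^sub>v ?s (?r v)"
      unfolding \<phi>_def map_sigma_mult_vec(1)[OF A rc[OF v]]
      using A E' cl by (intro assoc_mult_mat_vec[symmetric]) auto
    ultimately have 2: "E' *\<^sub>v ?s (\<phi> v) = - \<phi> (F *\<^sub>v ?t v)"
      unfolding e using A F cl by (auto intro!: eq_vecI)
    have EF: "E *\<^sub>v ?s v \<in> carrier_vec n" "F *\<^sub>v ?t v \<in> carrier_vec n"
      using E F cl by auto
    show ?thesis
      using v EF c[OF v] c[OF EF(1)] c[OF EF(2)]
      by (intro eq_vecI)
        (simp_all add: tau_twist_def M_EF_def coords_tau[OF x] add[of "_ + _"] add sm 1 2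
          pcompose_pCons)
  qed
  show ?thesis
    unfolding sl2_isomorphic_def sc sct
    using tau_twist_sl2_module[OF M] N lin bij actM by blast
qed

section \<open>The modules M(\<alpha>,a,K) are well defined\<close>

lemma P_mat_carrier: "P_mat a \<alpha> \<in> carrier_mat (size3 a) (size3 a)"
  unfolding P_mat_def by (rule block_diag3_carrier)

lemma P_bar_mult: "P_bar a \<alpha> * P_mat a \<alpha> = lambda_poly \<alpha> \<cdot>\<^sub>m 1\<^sub>m (size3 a)"
  using P_bar_props[of a \<alpha>] unfolding P_bar_eq by blast

text \<open>Diagonal matrices over a commutative ring commute.\<close>

lemma P_mult_bar: "P_mat a \<alpha> * P_bar a \<alpha> = lambda_poly \<alpha> \<cdot>\<^sub>m 1\<^sub>m (size3 a)"
proof -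
  have "P_mat a \<alpha> * P_bar a \<alpha> = P_bar a \<alpha> * P_mat a \<alpha>"
    by (cases a) (simp add: P_mat_def P_bar_eq block_diag3_def mult.commute[of "_ :: complex poly"])
  then show ?thesis by (simp add: P_bar_mult)
qed

lemma P_bar_carrier: "P_bar a \<alpha> \<in> carrier_mat (size3 a) (size3 a)"
  unfolding P_bar_eq by (rule block_diag3_carrier)

lemma GL_polyD:
  assumes "K \<in> GL_poly n"
  shows "K \<in> carrier_mat n n" "inv\<^bsub>poly_mat_ring n\<^esub> K \<in> carrier_mat n n"
    "K * inv\<^bsub>poly_mat_ring n\<^esub> K = 1\<^sub>m n" "inv\<^bsub>poly_mat_ring n\<^esub> K * K = 1\<^sub>m n"
proof -
  interpret R: ring "poly_mat_ring n" by (rule ring_mat)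
  show "K \<in> carrier_mat n n" "inv\<^bsub>poly_mat_ring n\<^esub> K \<in> carrier_mat n n"
    "K * inv\<^bsub>poly_mat_ring n\<^esub> K = 1\<^sub>m n" "inv\<^bsub>poly_mat_ring n\<^esub> K * K = 1\<^sub>m n"
    using R.Units_closed[OF assms] R.Units_inv_closed[OF assms] R.Units_r_inv[OF assms]
      R.Units_l_inv[OF assms]
    by (simp_all add: ring_mat_def)
qed

text \<open>Identifies the abstract inverse in the matrix ring with an explicit two-sided
  inverse.\<close>

lemma GL_polyI:
  assumes "A \<in> carrier_mat n n" "B \<in> carrier_mat n n" "A * B = 1\<^sub>m n" "B * A = 1\<^sub>m n"
  shows "A \<in> GL_poly n" "inv\<^bsub>poly_mat_ring n\<^esub> A = B"
proof -
  interpret R: ring "poly_mat_ring n" by (rule ring_mat)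
  show "A \<in> GL_poly n" using assms by (auto simp: Units_def ring_mat_def)
  show "inv\<^bsub>poly_mat_ring n\<^esub> A = B"
    by (rule R.inv_unique'[symmetric]) (use assms in \<open>auto simp: ring_mat_def\<close>)
qed

text \<open>This difference is the source of the term 2h in the relation required of E and
  F.\<close>

lemma sigma_lambda: "sigma (lambda_poly \<alpha>) - lambda_poly \<alpha> = [:0, 2:]"
  by (simp add: sigma_def lambda_poly_def pcompose_pCons algebra_simps)

lemma mult_cancel_middle:
  fixes X Y Z W :: "'a::comm_ring_1 mat"
  assumes "X \<in> carrier_mat n n" "Y \<in> carrier_mat n n" "Z \<in> carrier_mat n n" "W \<in> carrier_mat n n"
    and "Y * Z = c \<cdot>\<^sub>m 1\<^sub>m n"
  shows "(X * Y) * (Z * W) = c \<cdot>\<^sub>m (X * W)"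
proof -
  have "(X * Y) * (Z * W) = X * (Y * Z) * W"
    using assms(1-4) by (simp add: assoc_mult_mat[of _ n n _ n _ n])
  also have "\<dots> = c \<cdot>\<^sub>m (X * W)"
    unfolding assms(5) using assms(1-4)
    by (simp add: mult_smult_distrib[of _ n n _ n] mult_smult_assoc_mat[of _ n n _ n])
  finally show ?thesis .
qed

text \<open>Conjugation by K does not affect scalar matrices: E \<sigma>(F) is \<sigma> of K^-1
  (\<open>P_bar\<close> P) K, hence \<sigma>(\<lambda>), while F times \<open>sigma_inv\<close> of E
  is P (K K^-1) \<open>P_bar\<close>, hence \<lambda>. The two differ by 2h.\<close>

lemma M_aK_sl2_module:
  assumes K: "K \<in> GL_poly (size3 a)"
  shows "sl2_module (M_aK \<alpha> a K)"
proof -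
  let ?n = "size3 a" and ?K' = "inv\<^bsub>poly_mat_ring (size3 a)\<^esub> K"
  let ?X = "?K' * P_bar a \<alpha>" and ?F = "P_mat a \<alpha> * K"
  note Kc = GL_polyD[OF K]
  have X: "?X \<in> carrier_mat ?n ?n" and F: "?F \<in> carrier_mat ?n ?n"
    using Kc P_bar_carrier P_mat_carrier by (metis mult_carrier_mat)+
  have inv: "map_mat sigma_inv (map_mat sigma ?X) = ?X"
    by (intro eq_matI) (auto simp: sigma_inverse)
  have "map_mat sigma ?X * map_mat sigma ?F = map_mat sigma (?X * ?F)"
    unfolding sigma_pcompose using X F by (simp add: subst_mat_mult)
  also have "?X * ?F = lambda_poly \<alpha> \<cdot>\<^sub>m 1\<^sub>m ?n"
    using mult_cancel_middle[OF Kc(2) P_bar_carrier P_mat_carrier Kc(1) P_bar_mult] Kc(4) by simp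
  finally have 1: "map_mat sigma ?X * map_mat sigma ?F = sigma (lambda_poly \<alpha>) \<cdot>\<^sub>m 1\<^sub>m ?n"
    by (simp only:) (auto simp: sigma_def intro!: eq_matI)
  \<comment> \<open>The identity is written as a scalar matrix with c = 1 to fit
    \<open>mult_cancel_middle\<close>.\<close>
  have KK: "K * ?K' = 1 \<cdot>\<^sub>m 1\<^sub>m ?n" using Kc(3) by auto
  have 2: "?F * ?X = lambda_poly \<alpha> \<cdot>\<^sub>m 1\<^sub>m ?n"
    using mult_cancel_middle[OF P_mat_carrier Kc(1,2) P_bar_carrier KK] P_mult_bar by auto
  have "sigma (lambda_poly \<alpha>) \<cdot>\<^sub>m 1\<^sub>m ?n - lambda_poly \<alpha> \<cdot>\<^sub>m 1\<^sub>m ?n = [:0, 2:] \<cdot>\<^sub>m 1\<^sub>m ?n"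
    unfolding sigma_lambda[of \<alpha>, symmetric] by (intro eq_matI) auto
  then show ?thesis
    unfolding M_aK_def using X F
    by (intro M_EF_sl2_module) (auto simp: inv 1 2)
qed

section \<open>The constant matrices T and D and their effect on the diagonal factors\<close>

lemma T_mat_carrier: "T_mat n \<in> carrier_mat n n"
  by (simp add: T_mat_def)

text \<open>Row i of T has its only nonzero entry in column n-1-i, so one summand survives and the
  rows are reversed.\<close>

lemma T_mat_mult_left:
  assumes "A \<in> carrier_mat n m" "i < n" "j < m"
  shows "(T_mat n * A) $$ (i, j) = A $$ (n - 1 - i, j)"
proof -
  have "(T_mat n * A) $$ (i, j) = (\<Sum>k = 0..<n. (if i + k + 1 = n then 1 else 0) * A $$ (k, j))"
    using assms by (simp add: T_mat_def scalar_prod_def)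
  also have "\<dots> = (\<Sum>k = 0..<n. if k = n - 1 - i then A $$ (k, j) else 0)"
    using assms by (intro sum.cong) auto
  also have "\<dots> = A $$ (n - 1 - i, j)" using assms by simp
  finally show ?thesis .
qed

lemma T_mat_square: "T_mat n * T_mat n = 1\<^sub>m n"
proof (rule eq_matI)
  fix i j assume "i < dim_row (1\<^sub>m n :: complex poly mat)" "j < dim_col (1\<^sub>m n :: complex poly mat)"
  then have ij: "i < n" "j < n" by auto
  show "(T_mat n * T_mat n) $$ (i, j) = 1\<^sub>m n $$ (i, j)"
    unfolding T_mat_mult_left[OF T_mat_carrier ij] using ij by (auto simp: T_mat_def)
qed (simp_all add: T_mat_def)

lemma subst_T_mat: "subst_mat q (T_mat n) = T_mat n"
  by (intro eq_matI) (auto simp: T_mat_def pcompose_1)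

lemma D_mat_carrier: "D_mat (am, a0, ap) \<in> carrier_mat (am + a0 + ap) (am + a0 + ap)"
  using block_diag3_carrier[of "(ap, a0, am)"] by (simp add: D_mat_def size3_def add_ac)

lemma D_mat_square: "D_mat (am, a0, ap) * D_mat (am, a0, ap) = 1\<^sub>m (am + a0 + ap)"
  unfolding D_mat_def block_diag3_def prod.case mat_diag_diag
  by (intro eq_matI) (auto simp: mat_diag_def)

lemma subst_D_mat: "subst_mat q (D_mat a) = D_mat a"
  by (cases a) (auto simp: D_mat_def block_diag3_def mat_diag_def pcompose_uminus pcompose_1 intro!: eq_matI)

text \<open>At -h-1, \<open>P_bar\<close> has blocks \<lambda>, h-\<alpha>+1, -1, which T reverses.
  The blocks on the right are those of -P, namely -1, -(h-\<alpha>+1), \<lambda>. Only the middle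
  sign is off, and D corrects it.\<close>

lemma D_T_P_bar:
  "D_mat (am, a0, ap) * T_mat (am + a0 + ap) * subst_mat [:-1, -1:] (P_bar (am, a0, ap) \<alpha>)
    = - (P_mat (ap, a0, am) \<alpha> * T_mat (am + a0 + ap))"
proof -
  let ?n = "am + a0 + ap"
  have s: "subst_mat q (mat_diag ?n f) = mat_diag ?n (\<lambda>i. pcompose (f i) q)" for f q
    by (intro eq_matI) (auto simp: mat_diag_def)
  have n: "ap + a0 + am = ?n" by simp
  show ?thesis
    unfolding D_mat_def P_bar_eq P_mat_def block_diag3_def prod.case s n
      mat_diag_mult_left[OF T_mat_carrier]
    by (subst mat_diag_mult_right[of _ ?n], simp add: add_ac)
      (auto intro!: eq_matI simp: T_mat_def lambda_poly_def pcompose_pCons pcompose_uminus pcompose_mult pcompose_1)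
qed

text \<open>The blocks of \<sigma>(\<open>P_bar\<close>) are \<sigma>(\<lambda>), -(h+\<alpha>-1),
  -1; those of P(-h), reversed by T, are -\<sigma>(\<lambda>), -(h+\<alpha>-1), 1. The outer blocks
  are opposite and the middle ones agree, so D makes the sign uniform.\<close>

lemma P_bar_D_T:
  "map_mat sigma (P_bar (ap, a0, am) \<alpha>) * (D_mat (am, a0, ap) * T_mat (am + a0 + ap))
    = - (T_mat (am + a0 + ap) * subst_mat [:0, -1:] (P_mat (am, a0, ap) \<alpha>))"
proof -
  let ?n = "am + a0 + ap"
  have s: "subst_mat q (mat_diag ?n f) = mat_diag ?n (\<lambda>i. pcompose (f i) q)" for f q
    by (intro eq_matI) (auto simp: mat_diag_def)
  have n: "ap + a0 + am = ?n" by simp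
  show ?thesis
    unfolding D_mat_def P_bar_eq P_mat_def block_diag3_def prod.case s n sigma_pcompose
      mat_diag_mult_left[OF T_mat_carrier] mat_diag_mult_right[OF T_mat_carrier]
    by (subst mat_diag_mult_left[of _ ?n ?n], simp add: add_ac)
      (auto intro!: eq_matI simp: T_mat_def lambda_poly_def pcompose_pCons pcompose_uminus pcompose_mult pcompose_1)
qed

section \<open>The isomorphism for M(\<alpha>,a,K), obtained from the criterion\<close>

theorem proposition5p9:
  fixes n am a0 ap :: nat and \<alpha> :: complex and K :: "complex poly mat"
  assumes "n \<ge> 1"
    and "K \<in> GL_poly n"
    and "am + a0 + ap = n"
  shows "tau_twist (M_aK \<alpha> (am, a0, ap) K) \<simeq>\<^sub>s\<^sub>l\<^sub>2
    M_aK \<alpha> (ap, a0, am)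
      (T_mat n * inv\<^bsub>poly_mat_ring n\<^esub> (map_mat (\<lambda>g. pcompose g [:-2, -1:]) K)
        * T_mat n * D_mat (am, a0, ap))"
proof -
  define L where "L = inv\<^bsub>poly_mat_ring n\<^esub> K"
  note K = GL_polyD[OF assms(2), folded L_def]
  define T where "T = T_mat n"
  define D where "D = D_mat (am, a0, ap)"
  define P where "P = P_mat (am, a0, ap) \<alpha>"
  define Q where "Q = P_bar (am, a0, ap) \<alpha>"
  define P' where "P' = P_mat (ap, a0, am) \<alpha>"
  define Q' where "Q' = P_bar (ap, a0, am) \<alpha>"
  have sz: "size3 (am, a0, ap) = n" "size3 (ap, a0, am) = n" using assms(3) by (simp_all add: size3_def)
  have c: "T \<in> carrier_mat n n" "D \<in> carrier_mat n n" "P \<in> carrier_mat n n" "Q \<in> carrier_mat n n"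
    "P' \<in> carrier_mat n n" "Q' \<in> carrier_mat n n"
    using T_mat_carrier D_mat_carrier[of am a0 ap] P_mat_carrier[of "(am, a0, ap)"]
      P_bar_carrier[of "(am, a0, ap)"] P_mat_carrier[of "(ap, a0, am)"] P_bar_carrier[of "(ap, a0, am)"]
    unfolding sz assms(3) T_def D_def P_def Q_def P'_def Q'_def by auto
  have TT: "T * T = 1\<^sub>m n" and DD: "D * D = 1\<^sub>m n"
    using T_mat_square D_mat_square[of am a0 ap] by (simp_all add: T_def D_def assms(3))
  have sT: "subst_mat q T = T" and sD: "subst_mat q D = D" for q
    by (simp_all add: T_def D_def subst_T_mat subst_D_mat)
  have DTQ: "D * T * subst_mat [:-1, -1:] Q = - (P' * T)"
    and QDT: "map_mat sigma Q' * (D * T) = - (T * subst_mat [:0, -1:] P)"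
    using D_T_P_bar[of am a0 ap] P_bar_D_T[of ap a0 am]
    by (simp_all add: D_def T_def Q_def P'_def Q'_def P_def assms(3))
  have KL: "subst_mat q K * subst_mat q L = 1\<^sub>m n" "subst_mat q L * subst_mat q K = 1\<^sub>m n" for q
    using K by (simp_all add: subst_mat_mult[symmetric] subst_mat_one)
  have Kc: "subst_mat q K \<in> carrier_mat n n" "subst_mat q L \<in> carrier_mat n n" for q
    using K by auto
  \<comment> \<open>Substitution is a ring homomorphism on matrices, so it commutes with
    inversion.\<close>
  have inv2: "inv\<^bsub>poly_mat_ring n\<^esub> (subst_mat [:-2, -1:] K) = subst_mat [:-2, -1:] L"
    by (rule GL_polyI(2)) (use KL Kc in auto)
  have mc: "X * Y \<in> carrier_mat n n" if "X \<in> carrier_mat n n" "Y \<in> carrier_mat n n"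
    for X Y :: "complex poly mat"
    using that by (rule mult_carrier_mat)
  note as = assoc_mult_mat[of _ n n _ n _ n]
  \<comment> \<open>Products are kept associated to the right; this form removes an adjacent inverse
    pair inside a longer product.\<close>
  have cancel: "X * (Y * Z) = Z" if "X * Y = 1\<^sub>m n" "X \<in> carrier_mat n n" "Y \<in> carrier_mat n n"
    "Z \<in> carrier_mat n n" for X Y Z :: "complex poly mat"
    using that as[of X Y Z] by simp
  define K' where "K' = T * subst_mat [:-2, -1:] L * T * D"
  \<comment> \<open>The inverse of \<open>K'\<close>: factors in reverse order, with T and D their
    own inverses.\<close>
  define L' where "L' = D * T * subst_mat [:-2, -1:] K * T"
  have K'c: "K' \<in> carrier_mat n n" "L' \<in> carrier_mat n n"
    using c Kc by (auto simp: K'_def L'_def)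
  have K'L': "K' * L' = 1\<^sub>m n" "L' * K' = 1\<^sub>m n"
    unfolding K'_def L'_def using c Kc
    by (simp_all add: mc as cancel[OF TT] cancel[OF DD] cancel[OF KL(1)] cancel[OF KL(2)] TT DD)
  have K'GL: "K' \<in> GL_poly n" and K'inv: "inv\<^bsub>poly_mat_ring n\<^esub> K' = L'"
    using GL_polyI[OF K'c K'L'] .
  \<comment> \<open>The argument -h-1 lies midway: \<sigma> turns it into -h, as in F(-h), and
    \<open>sigma_inv\<close> turns it into -h-2, as in \<open>K'\<close>.\<close>
  define A where "A = D * T * subst_mat [:-1, -1:] K"
  define B where "B = subst_mat [:-1, -1:] L * T * D"
  let ?E = "map_mat sigma (L * Q)" and ?F = "P * K"
  let ?E' = "map_mat sigma (L' * Q')" and ?F' = "P' * K'"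
  have M: "M_aK \<alpha> (am, a0, ap) K = M_EF n ?E ?F"
    by (simp add: M_aK_def sz L_def Q_def P_def)
  have N: "M_aK \<alpha> (ap, a0, am) K' = M_EF n ?E' ?F'"
    by (simp add: M_aK_def sz K'inv Q'_def P'_def)
  have R: "subst_mat [:0, -1:] P \<in> carrier_mat n n" "subst_mat [:-1, -1:] Q \<in> carrier_mat n n"
    "map_mat sigma Q' \<in> carrier_mat n n"
    using c by auto
  have "tau_twist (M_EF n ?E ?F) \<simeq>\<^sub>s\<^sub>l\<^sub>2 M_EF n ?E' ?F'"
  proof (rule M_EF_tau_twist_iso[where A = A and B = B])
    show "A * B = 1\<^sub>m n" "B * A = 1\<^sub>m n"
      unfolding A_def B_def using c Kc
      by (simp_all add: mc as cancel[OF TT] cancel[OF DD] cancel[OF KL(1)] cancel[OF KL(2)] TT DD KL)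
    show "sl2_module (M_EF n ?E ?F)" "sl2_module (M_EF n ?E' ?F')"
      using M_aK_sl2_module[of K "(am, a0, ap)" \<alpha>] M_aK_sl2_module[of K' "(ap, a0, am)" \<alpha>]
        assms(2) K'GL
      unfolding sz M N by auto
    have sA: "map_mat sigma A = D * T * subst_mat [:0, -1:] K"
      "map_mat sigma_inv A = D * T * subst_mat [:-2, -1:] K"
      unfolding A_def sigma_pcompose using c Kc
      by (simp_all add: subst_mat_mult[of _ n] sT sD subst_mat_subst pcompose_pCons mc as)
    \<comment> \<open>Here \<sigma> moves the argument -h-2 of \<open>L'\<close> to -h-1, so E'
      begins with the factor A.\<close>
    have sE': "?E' = D * T * subst_mat [:-1, -1:] K * T * map_mat sigma Q'"
      unfolding L'_def sigma_pcompose using c Kc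
      by (simp add: subst_mat_mult[of _ n] sT sD subst_mat_subst pcompose_pCons mc as)
    have "?E' * map_mat sigma A = A * (T * (map_mat sigma Q' * (D * T)) * subst_mat [:0, -1:] K)"
      unfolding sA sE' unfolding A_def using c Kc R by (simp add: mc as)
    also have "\<dots> = A * (- (subst_mat [:0, -1:] P * subst_mat [:0, -1:] K))"
      unfolding QDT using c Kc R by (simp add: cancel[OF TT] uminus_mult_right_mat uminus_mult_left_mat)
    also have "\<dots> = - (A * subst_mat [:0, -1:] ?F)"
      using c K A_def R by (simp add: subst_mat_mult[of _ n] uminus_mult_right_mat)
    finally show "?E' * map_mat sigma A = - (A * subst_mat [:0, -1:] ?F)" .
    \<comment> \<open>The factor K(-h-2) of the shifted A cancels its inverse in
      \<open>K'\<close>.\<close>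
    have "?F' * map_mat sigma_inv A = P' * T"
      unfolding sA K'_def using c Kc
      by (simp add: mc as cancel[OF TT] cancel[OF DD] cancel[OF KL(2)] KL)
    \<comment> \<open>Applying \<sigma> and then h -> -h gives h -> -h-1, so K(-h-1) in A cancels
      the inverse in E, and \<open>DTQ\<close> compares what remains.\<close>
    moreover have "A * subst_mat [:0, -1:] ?E = D * T * subst_mat [:-1, -1:] Q"
      unfolding A_def sigma_pcompose using c K Kc R
      by (simp add: subst_mat_mult[of _ n] subst_mat_subst pcompose_pCons mc as cancel[OF KL(1)])
    ultimately show "?F' * map_mat sigma_inv A = - (A * subst_mat [:0, -1:] ?E)"
      unfolding DTQ using c by auto
  qed (use c K Kc K'c in \<open>auto simp: A_def B_def\<close>)
  then show ?thesis
    unfolding inv2 M[symmetric] N[symmetric] unfolding K'_def T_def D_def .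
qed

end
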